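(* Let $\mathcal{M}=\{(M_i,\varphi_i)\}_{i=1}^n$ be a persistence module over a field $\mathbb{F}$. For each $i\in\{1,\dots,n\}$ let $\mathcal{V}^i$ be an adapted basis for the flag of kernels in $M_i$ which contains a basis $\mathcal{V}^i_{\mathrm{Im}}$ of $\operatorname{im}(\varphi_{i-1})$ as a subset, and let $\mathcal{V}^i_{\mathrm{Birth}}=\mathcal{V}^i\setminus\mathcal{V}^i_{\mathrm{Im}}$. Then the set $\mathscr{V}:=\bigcup_{i}\mathcal{V}^i_{\mathrm{Birth}}$ is an interval basis for $\mathcal{M}$.
   Context: A persistence module $\mathcal{M}=\{(M_i,\varphi_i)\}_{i=1}^n$ over a field $\mathbb{F}$ consists of finite-dimensional $\mathbb{F}$-vector spaces $M_1,\dots,M_n$ and linear maps $\varphi_i:M_i\to M_{i+1}$ for $1\le i\le n-1$. By convention, $M_k=0$ for $k\le 0$ and for $k\ge n+1$, and all maps $\varphi_k$ from or to these spaces are zero (in particular $\varphi_0=0$ and $\varphi_n:M_n\to M_{n+1}$ is the null map). For $i<j$ put $\varphi_{i,j}=\varphi_{j-1}\circ\cdots\circ\varphi_i:M_i\to M_j$, and $\varphi_{i,i}=\mathrm{id}$. Flag of kernels: for each $i\in\{1,\dots,n\}$ there is the flag $0\subseteq\ker(\varphi_{i,i+1})\subseteq\ker(\varphi_{i,i+2})\subseteq\dots\subseteq\ker(\varphi_{i,n+1})=M_i$. An adapted basis for the flag in $M_i$ is a set $\mathcal{V}^i$ of $m_i=\dim M_i$ linearly independent vectors of $M_i$ together with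 an index function $J:\mathcal{V}^i\to\{1,\dots,n-i+1\}$ such that $\ker(\varphi_{i,i+s})=\langle\{v\in\mathcal{V}^i : J(v)\le s\}\rangle$ for all $1\le s\le n-i+1$, where $\langle\cdot\rangle$ denotes linear span. Homogeneous elements are elements of some $M_b$ (elements of different $M_b$ are regarded as distinct). For $v\in M_b$, $I(v)$ is the submodule of $\mathcal{M}$ with steps $I_i(v)=\langle\varphi_{b,i}(v)\rangle$ if $i\ge b$ and $I_i(v)=0$ if $i<b$, with structure maps the restrictions of the $\varphi_i$. A finite family $\{v_1,\dots,v_N\}$ of non-zero homogeneous elements is an interval basis for $\mathcal{M}$ if $\bigoplus_{m=1}^N I(v_m)=\mathcal{M}$, i.e. for every $i$ the space $M_i$ is the internal direct sum of the subspaces $I_i(v_1),\dots,I_i(v_N)$. *)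

theory Defs
  imports "Jordan_Normal_Form.Missing_VectorSpace"
begin

(* The spaces are indexed by all natural numbers; the assumption zero_outside expresses the
   convention that M_k = 0 unless 1 <= k <= n.  The maps from or to those spaces are then
   automatically zero, and every phi i : M_i -> M_(i+1) is a linear map. *)
locale persistence_module =
  field K for K :: "('a, 'r) ring_scheme" (structure) +
  fixes n :: nat
    and M :: "nat \<Rightarrow> ('a, 'v, 'm) module_scheme"
    and \<phi> :: "nat \<Rightarrow> 'v \<Rightarrow> 'v"
  assumes vector_space: "vectorspace K (M i)"
    and finite_dimensional: "vectorspace.fin_dim K (M i)"
    and structure_map: "linear_map K (M i) (M (i + 1)) (\<phi> i)"
    and zero_outside: "i \<notin> {1..n} \<Longrightarrow> carrier (M i) = {\<zero>\<^bsub>M i\<^esub>}"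

(* phi_(i,j) = phi_(j-1) o ... o phi_i  for i < j, and the identity for i = j *)
definition comp_map :: "(nat \<Rightarrow> 'v \<Rightarrow> 'v) \<Rightarrow> nat \<Rightarrow> nat \<Rightarrow> 'v \<Rightarrow> 'v" where
  "comp_map \<phi> i j = fold \<phi> [i..<j]"

definition kernel_step ::
  "(nat \<Rightarrow> ('a, 'v, 'm) module_scheme) \<Rightarrow> (nat \<Rightarrow> 'v \<Rightarrow> 'v) \<Rightarrow> nat \<Rightarrow> nat \<Rightarrow> 'v set" where
  "kernel_step M \<phi> i s = mod_hom.ker (M i) (M (i + s)) (comp_map \<phi> i (i + s))"

definition adapted_basis ::
  "('a, 'r) ring_scheme \<Rightarrow> nat \<Rightarrow> (nat \<Rightarrow> ('a, 'v, 'm) module_scheme) \<Rightarrow> (nat \<Rightarrow> 'v \<Rightarrow> 'v) \<Rightarrow>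
    nat \<Rightarrow> 'v set \<Rightarrow> ('v \<Rightarrow> nat) \<Rightarrow> bool" where
  "adapted_basis K n M \<phi> i V J \<longleftrightarrow>
     V \<subseteq> carrier (M i) \<and> finite V \<and> card V = vectorspace.dim K (M i) \<and>
     \<not> module.lin_dep K (M i) V \<and>
     J \<in> V \<rightarrow> {1..n - i + 1} \<and>
     (\<forall>s\<in>{1..n - i + 1}. kernel_step M \<phi> i s = module.span K (M i) {v \<in> V. J v \<le> s})"

definition internal_direct_sum ::
  "('a, 'r) ring_scheme \<Rightarrow> ('a, 'v, 'm) module_scheme \<Rightarrow> 'i set \<Rightarrow> ('i \<Rightarrow> 'v set) \<Rightarrow> bool" where
  "internal_direct_sum K V S U \<longleftrightarrow>
     (\<forall>s\<in>S. subspace K (U s) V) \<and>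
     (\<forall>x\<in>carrier V. \<exists>!f. f \<in> (\<Pi>\<^sub>E s\<in>S. U s) \<and> (\<Oplus>\<^bsub>V\<^esub> s\<in>S. f s) = x)"

(* A homogeneous element v of M_b is the pair (b, v), so that elements of different spaces are
   distinct.  The step of the submodule I(v) in degree i: *)
definition interval_step ::
  "('a, 'r) ring_scheme \<Rightarrow> (nat \<Rightarrow> ('a, 'v, 'm) module_scheme) \<Rightarrow> (nat \<Rightarrow> 'v \<Rightarrow> 'v) \<Rightarrow>
    nat \<times> 'v \<Rightarrow> nat \<Rightarrow> 'v set" where
  "interval_step K M \<phi> = (\<lambda>(b, v) i.
     if b \<le> i then module.span K (M i) {comp_map \<phi> b i v} else {\<zero>\<^bsub>M i\<^esub>})"

definition interval_basis ::
  "('a, 'r) ring_scheme \<Rightarrow> (nat \<Rightarrow> ('a, 'v, 'm) module_scheme) \<Rightarrow> (nat \<Rightarrow> 'v \<Rightarrow> 'v) \<Rightarrow>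
    (nat \<times> 'v) set \<Rightarrow> bool" where
  "interval_basis K M \<phi> S \<longleftrightarrow>
     finite S \<and>
     (\<forall>(b, v)\<in>S. v \<in> carrier (M b) \<and> v \<noteq> \<zero>\<^bsub>M b\<^esub>) \<and>
     (\<forall>i. internal_direct_sum K (M i) S (\<lambda>h. interval_step K M \<phi> h i))"

end

theory Submission
  imports Defs
begin

text \<open>
  Generation follows by induction on the degree, since every space is the sum of the image of the
  preceding map and the span of the births.  For independence, uniqueness of the decomposition alone
  does not survive the induction, because the structure maps need not be injective.  The statement
  that does is: if a sum of elements of the interval submodules lies in the kernel of
  \<open>\<phi>\<^sub>i\<^sub>,\<^sub>i\<^sub>+\<^sub>s\<close>, then so does every summand.  Since that kernel is spanned by a part of the adapted basis,
  the image part and the birth summands of such a sum lie in it separately, and the image part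
  comes from an element of the kernel of \<open>\<phi>\<^sub>i\<^sub>-\<^sub>1\<^sub>,\<^sub>i\<^sub>+\<^sub>s\<close>, to which the induction hypothesis applies
  with \<open>s + 1\<close>.  The case \<open>s = 0\<close> is uniqueness.
\<close>

section \<open>Finite sums, linear maps and submodules\<close>

lemma (in mod_hom) f_finsum:
  assumes "g \<in> A \<rightarrow> carrier M"
  shows "f (finsum M g A) = finsum N (\<lambda>x. f (g x)) A"
  using assms
proof (induction A rule: infinite_finite_induct)
  case (insert x A)
  then have "g x \<in> carrier M" "g \<in> A \<rightarrow> carrier M"
    by auto
  moreover from this have "(\<lambda>y. f (g y)) \<in> A \<rightarrow> carrier N" "f (g x) \<in> carrier N"
    by auto
  ultimately show ?case
    using insert by (simp add: M.M.finsum_insert N.M.finsum_insert M.M.finsum_closed)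
\<comment> \<open>Over an infinite index set both sums have the default value zero.\<close>
qed (simp_all add: M.M.finsum_infinite N.M.finsum_infinite)

lemma linear_map_id: "vectorspace K V \<Longrightarrow> linear_map K V V id"
  unfolding linear_map_def mod_hom_def mod_hom_axioms_def module_hom_def vectorspace_def
  by auto

lemma linear_map_comp:
  assumes "linear_map K U V S" "linear_map K V W T"
  shows "linear_map K U W (T \<circ> S)"
proof -
  interpret S: linear_map K U V S by fact
  interpret T: linear_map K V W T by fact
  show ?thesis
    by unfold_locales (auto simp: module_hom_def)
qed

lemma (in module) submodule_finsum_closed:
  assumes "submodule R N M" "f \<in> A \<rightarrow> N"
  shows "finsum M f A \<in> N"
proof -
  interpret N: submodule R N M by fact
  show ?thesis
    using assms(2)
  proof (induction A rule: infinite_finite_induct)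
    case (insert x A)
    then have "f \<in> A \<rightarrow> carrier M" "f x \<in> carrier M"
      using N.subset by auto
    then show ?case
      using insert by (auto simp: M.finsum_insert)
  qed (simp_all add: M.finsum_infinite)
qed

section \<open>Coefficients with respect to a linearly independent set\<close>

context vectorspace
begin

lemma span_singleton:
  assumes "v \<in> carrier V"
  shows "span {v} = {a \<odot>\<^bsub>V\<^esub> v |a. a \<in> carrier K}"
proof -
  have "lincomb a {v} = a v \<odot>\<^bsub>V\<^esub> v" if "a v \<in> carrier K" for a
    using that assms by (simp add: lincomb_def)
  moreover have "\<exists>f. f v = a \<and> f \<in> {v} \<rightarrow> carrier K" if "a \<in> carrier K" for a
    using that by (intro exI[of _ "\<lambda>_. a"]) auto
  ultimately show ?thesis
    using assms by (auto simp: finite_span) metis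
qed

lemma finsum_eq_lincomb:
  assumes "A \<subseteq> carrier V" "\<And>v. v \<in> A \<Longrightarrow> f v \<in> span {v}"
  obtains a where "a \<in> A \<rightarrow> carrier K" "\<And>v. v \<in> A \<Longrightarrow> f v = a v \<odot>\<^bsub>V\<^esub> v"
    "finsum V f A = lincomb a A"
proof -
  have "\<forall>v\<in>A. \<exists>c. c \<in> carrier K \<and> f v = c \<odot>\<^bsub>V\<^esub> v"
    using assms span_singleton by blast
  then obtain a where a: "\<And>v. v \<in> A \<Longrightarrow> a v \<in> carrier K" "\<And>v. v \<in> A \<Longrightarrow> f v = a v \<odot>\<^bsub>V\<^esub> v"
    by metis
  moreover have "finsum V f A = lincomb a A"
    unfolding lincomb_def using a assms(1) by (intro M.finsum_cong') auto
  ultimately show ?thesis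
    using that[of a] by auto
qed

lemma lincomb_eqD:
  assumes "finite B" "B \<subseteq> carrier V" "lin_indpt B"
    and "a \<in> B \<rightarrow> carrier K" "b \<in> B \<rightarrow> carrier K" "lincomb a B = lincomb b B" "v \<in> B"
  shows "a v = b v"
proof -
  have "lincomb (\<lambda>v. a v \<ominus>\<^bsub>K\<^esub> b v) B = \<zero>\<^bsub>V\<^esub>"
    using assms by (simp add: lincomb_diff M.r_neg M.minus_eq)
  then have "(\<lambda>v. a v \<ominus>\<^bsub>K\<^esub> b v) \<in> B \<rightarrow> {\<zero>\<^bsub>K\<^esub>}"
    using assms by (intro not_lindepD[of B]) auto
  then show ?thesis
    using assms by (auto simp: Pi_iff)
qed

lemma lincomb_in_span:
  assumes "finite A" "A \<subseteq> carrier V" "a \<in> A \<rightarrow> carrier K" "C \<subseteq> carrier V"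
    and "\<And>v. v \<in> A \<Longrightarrow> v \<notin> C \<Longrightarrow> a v = \<zero>\<^bsub>K\<^esub>"
  shows "lincomb a A \<in> span C"
  unfolding lincomb_def
proof (rule submodule_finsum_closed[OF span_is_submodule[OF assms(4)]], rule)
  interpret C: submodule K "span C" V
    by (rule span_is_submodule[OF assms(4)])
  fix v assume v: "v \<in> A"
  show "a v \<odot>\<^bsub>V\<^esub> v \<in> span C"
  proof (cases "v \<in> C")
    case True
    with v assms show ?thesis
      by (auto intro: span_mem)
  next
    case False
    with v assms show ?thesis
      by (auto simp: subsetD)
  qed
qed

text \<open>The given sum has two expansions in \<open>B\<close>: one glued from coefficients on
  \<open>A\<close> and on \<open>B - A\<close>, the other supported on \<open>C\<close>. Comparing
  them kills every coefficient outside \<open>C\<close>, so \<open>y\<close> and each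
  \<open>f v\<close> separately keep only vectors of \<open>C\<close>. It will be applied with
  \<open>A\<close> a basis of an image and \<open>C\<close> a part of the basis that spans a
  kernel.\<close>

lemma adapted_decomposition:
  assumes B: "finite B" "B \<subseteq> carrier V" "lin_indpt B" and "A \<subseteq> B" "C \<subseteq> B"
    and y: "y \<in> span A" and f: "\<And>v. v \<in> B - A \<Longrightarrow> f v \<in> span {v}"
    and sum: "y \<oplus>\<^bsub>V\<^esub> finsum V f (B - A) \<in> span C"
  shows "y \<in> span C" "\<And>v. v \<in> B - A \<Longrightarrow> f v \<in> span C"
proof -
  have fin: "finite A" "finite C" and car: "A \<subseteq> carrier V" "C \<subseteq> carrier V" "B - A \<subseteq> carrier V"
    using assms by (auto intro: finite_subset)
  obtain c where c: "c \<in> A \<rightarrow> carrier K" "lincomb c A = y"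
    using finite_in_span[OF fin(1) car(1) y] by blast
  obtain a where a: "a \<in> (B - A) \<rightarrow> carrier K" "\<And>v. v \<in> B - A \<Longrightarrow> f v = a v \<odot>\<^bsub>V\<^esub> v"
    "finsum V f (B - A) = lincomb a (B - A)"
    using finsum_eq_lincomb[OF car(3) f] by metis
  obtain e where e: "e \<in> C \<rightarrow> carrier K"
    "lincomb e C = y \<oplus>\<^bsub>V\<^esub> finsum V f (B - A)"
    using finite_in_span[OF fin(2) car(2) sum] by blast
  \<comment> \<open>The two expansions over all of \<open>B\<close>: \<open>?d\<close> glues
    \<open>c\<close> and \<open>a\<close>, and \<open>?e\<close> extends \<open>e\<close> by
    zero.\<close>
  let ?d = "\<lambda>v. if v \<in> A then c v else a v"
  let ?e = "\<lambda>v. if v \<in> C then e v else \<zero>\<^bsub>K\<^esub>"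
  have d: "?d \<in> B \<rightarrow> carrier K" "?e \<in> B \<rightarrow> carrier K"
    using a(1) c(1) e(1) by auto
  have "lincomb ?d B = lincomb c A \<oplus>\<^bsub>V\<^esub> lincomb a (B - A)"
    using lincomb_union2[of A "B - A" c a] B(1,2) a(1) c(1) fin car \<open>A \<subseteq> B\<close>
    by (simp add: Un_absorb1)
  also have "\<dots> = lincomb e C"
    using a(3) c(2) e(2) by simp
  also have "\<dots> = lincomb ?e C"
    using car(2) e(1) by (intro lincomb_cong) auto
  also have "\<dots> = lincomb ?e B"
  proof -
    have "lincomb ?e B = lincomb ?e C \<oplus>\<^bsub>V\<^esub> lincomb ?e (B - C)"
      using lincomb_union[of C "B - C" ?e] B(1,2) d(2) \<open>C \<subseteq> B\<close> car(2) fin(2)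
        by (auto simp: Un_absorb1)
    moreover have "lincomb ?e (B - C) = \<zero>\<^bsub>V\<^esub>"
      using B(2) by (intro lincomb_zero) auto
    ultimately show ?thesis
      using car(2) e(1) by (simp add: lincomb_closed Pi_iff)
  qed
  finally have "?d v = ?e v" if "v \<in> B" for v
    using lincomb_eqD[OF B d] that by blast
  then have coeff: "c v = \<zero>\<^bsub>K\<^esub>" if "v \<in> A" "v \<notin> C" for v
    using that \<open>A \<subseteq> B\<close> by (metis subsetD)
  have coeff': "a v = \<zero>\<^bsub>K\<^esub>" if "v \<in> B - A" "v \<notin> C" for v
    using \<open>\<And>v. v \<in> B \<Longrightarrow> ?d v = ?e v\<close>[of v] that by auto
  show "y \<in> span C"
    using lincomb_in_span[OF fin(1) car(1) c(1) car(2) coeff] c(2) by simp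
  fix v assume v: "v \<in> B - A"
  interpret C: submodule K "span C" V
    by (rule span_is_submodule[OF car(2)])
  show "f v \<in> span C"
  proof (cases "v \<in> C")
    case True
    with v a car show ?thesis
      by (auto intro: span_mem)
  next
    case False
    with v a(2) coeff' car(3) show ?thesis
      by (auto simp: subsetD)
  qed
qed

end

section \<open>Composite structure maps, their kernels and the interval submodules\<close>

context persistence_module
begin

sublocale step: vectorspace K "M i" for i
  by (rule vector_space)

sublocale map: linear_map K "M i" "M (Suc i)" "\<phi> i" for i
  using structure_map[of i] by simp

lemma comp_map_self: "comp_map \<phi> i i = id"
  by (simp add: comp_map_def)

lemma comp_map_Suc_right: "i \<le> j \<Longrightarrow> comp_map \<phi> i (Suc j) = \<phi> j \<circ> comp_map \<phi> i j"
  by (simp add: comp_map_def)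

lemma comp_map_Suc_left: "i < j \<Longrightarrow> comp_map \<phi> i j = comp_map \<phi> (Suc i) j \<circ> \<phi> i"
  by (simp add: comp_map_def upt_conv_Cons)

lemma comp_map_linear:
  assumes "i \<le> j"
  shows "linear_map K (M i) (M j) (comp_map \<phi> i j)"
  using assms
proof (induction j rule: dec_induct)
  case base
  show ?case
    unfolding comp_map_self by (rule linear_map_id[OF vector_space])
next
  case (step j)
  then show ?case
    unfolding comp_map_Suc_right[OF \<open>i \<le> j\<close>]
    by (intro linear_map_comp[OF _ map.linear_map_axioms])
qed

lemma comp_map_closed: "i \<le> j \<Longrightarrow> v \<in> carrier (M i) \<Longrightarrow> comp_map \<phi> i j v \<in> carrier (M j)"
  using mod_hom.f_im[of K "M i" "M j" "comp_map \<phi> i j" v] comp_map_linear[of i j]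
  by (simp add: linear_map_def)

lemma kernel_step_eq:
  "kernel_step M \<phi> i s = {x \<in> carrier (M i). comp_map \<phi> i (i + s) x = \<zero>\<^bsub>M (i + s)\<^esub>}"
proof -
  interpret linear_map K "M i" "M (i + s)" "comp_map \<phi> i (i + s)"
    by (rule comp_map_linear) simp
  show ?thesis
    by (simp add: kernel_step_def ker_def)
qed

lemma kernel_step_submodule: "submodule K (kernel_step M \<phi> i s) (M i)"
proof -
  interpret linear_map K "M i" "M (i + s)" "comp_map \<phi> i (i + s)"
    by (rule comp_map_linear) simp
  show ?thesis
    using ker_is_submodule by (simp add: kernel_step_def)
qed

lemma kernel_step_0: "kernel_step M \<phi> i 0 = {\<zero>\<^bsub>M i\<^esub>}"
  by (auto simp: kernel_step_eq comp_map_self)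

text \<open>Both sides say that \<open>x\<close> becomes zero in degree \<open>Suc i + s\<close>;
  counted from degree \<open>i\<close>, this takes one map more. This is how kernel membership is
  carried between neighbouring degrees.\<close>

lemma map_in_kernel_step_iff:
  assumes "x \<in> carrier (M i)"
  shows "\<phi> i x \<in> kernel_step M \<phi> (Suc i) s \<longleftrightarrow> x \<in> kernel_step M \<phi> i (Suc s)"
  using assms by (simp add: kernel_step_eq comp_map_Suc_left[of i])

lemma interval_step_submodule:
  assumes "v \<in> carrier (M b)"
  shows "submodule K (interval_step K M \<phi> (b, v) i) (M i)"
proof (cases "b \<le> i")
  case True
  then show ?thesis
    using assms by (simp add: interval_step_def step.span_is_submodule comp_map_closed)
next
  case False
  then show ?thesis
    using step.span_is_submodule[of "{}" i] by (simp add: interval_step_def step.span_empty)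
qed

lemma interval_step_birth: "interval_step K M \<phi> (b, v) b = step.span b {v}"
  by (simp add: interval_step_def comp_map_self)

lemma interval_step_before: "i < b \<Longrightarrow> interval_step K M \<phi> (b, v) i = {\<zero>\<^bsub>M i\<^esub>}"
  by (simp add: interval_step_def)

text \<open>From the degree \<open>b\<close> on, the structure map carries generator to generator,
  and before \<open>b\<close> both sides are zero. The case \<open>b = Suc i\<close> is excluded
  because there the interval starts: the right-hand side is zero, while the left-hand side is
  spanned by \<open>v\<close>.\<close>

lemma interval_step_Suc:
  assumes "v \<in> carrier (M b)" "b \<noteq> Suc i"
  shows "interval_step K M \<phi> (b, v) (Suc i) = \<phi> i ` interval_step K M \<phi> (b, v) i"
proof (cases "b \<le> i")
  case True
  then have "comp_map \<phi> b i v \<in> carrier (M i)"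
    using assms by (simp add: comp_map_closed)
  then have "step.span (Suc i) {\<phi> i (comp_map \<phi> b i v)} = \<phi> i ` step.span i {comp_map \<phi> b i v}"
    by (force simp: step.span_singleton)
  then show ?thesis
    using True by (simp add: interval_step_def comp_map_Suc_right)
next
  case False
  then show ?thesis
    using assms by (simp add: interval_step_def)
qed

end

section \<open>Adapted bases and the births in them\<close>

locale adapted_bases = persistence_module +
  fixes V V_Im V_Birth :: "nat \<Rightarrow> 'c set" and J :: "nat \<Rightarrow> 'c \<Rightarrow> nat"
  assumes adapted: "i \<in> {1..n} \<Longrightarrow> adapted_basis K n M \<phi> i (V i) (J i)"
    and V_Im_subset: "i \<in> {1..n} \<Longrightarrow> V_Im i \<subseteq> V i"
    and V_Im_basis: "i \<in> {1..n} \<Longrightarrow>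
      vectorspace.basis K ((M i)\<lparr>carrier := mod_hom.im (M (i - 1)) (\<phi> (i - 1))\<rparr>) (V_Im i)"
    and V_Birth_eq: "i \<in> {1..n} \<Longrightarrow> V_Birth i = V i - V_Im i"
begin

definition births :: "(nat \<times> 'c) set" where
  "births = (SIGMA i:{1..n}. V_Birth i)"

abbreviation I :: "nat \<Rightarrow> nat \<times> 'c \<Rightarrow> 'c set" where
  "I i h \<equiv> interval_step K M \<phi> h i"

lemma V_basis:
  assumes "i \<in> {1..n}"
  shows "finite (V i)" "V i \<subseteq> carrier (M i)" "step.lin_indpt i (V i)" "step.basis i (V i)"
  using adapted[OF assms] step.dim_li_is_basis[OF finite_dimensional, of "V i"]
  by (auto simp: adapted_basis_def)

text \<open>\<open>V_Im\<close> is a basis of the image regarded as a space of its own; spans taken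
  in a submodule agree with spans taken in the ambient space.\<close>

lemma span_V_Im:
  assumes "Suc i \<in> {1..n}"
  shows "step.span (Suc i) (V_Im (Suc i)) = \<phi> i ` carrier (M i)"
proof -
  let ?im = "\<phi> i ` carrier (M i)"
  have sub: "submodule K ?im (M (Suc i))"
    using map.im_is_submodule[of i] by (simp add: map.im_def)
  then have "subspace K ?im (M (Suc i))"
    by (simp add: subspace_def vector_space)
  then interpret im: vectorspace K "(M (Suc i))\<lparr>carrier := ?im\<rparr>"
    by (rule step.subspace_is_vs)
  have "im.basis (V_Im (Suc i))"
    using V_Im_basis[OF assms] by (simp add: map.im_def)
  then show ?thesis
    using step.span_li_not_depend(1)[OF _ sub, of "V_Im (Suc i)"] by (simp add: im.basis_def)
qed

text \<open>The adapted basis covers only steps from 1 to \<open>n - i + 1\<close>. For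
  \<open>s = 0\<close> the kernel is zero and \<open>C\<close> is empty; once \<open>i + s\<close>
  exceeds \<open>n\<close> the target is zero, so the kernel is everything and \<open>C\<close> is
  the whole basis.\<close>

lemma kernel_step_is_span:
  assumes "i \<in> {1..n}"
  obtains C where "C \<subseteq> V i" "kernel_step M \<phi> i s = step.span i C"
proof -
  consider "s = 0" | "s \<in> {1..n - i + 1}" | "n < i + s"
    using assms by force
  then show ?thesis
  proof cases
    case 1
    then show ?thesis
      using that[of "{}"] by (simp add: kernel_step_0 step.span_empty)
  next
    case 2
    then show ?thesis
      using that[of "{v \<in> V i. J i v \<le> s}"] adapted[OF assms] by (auto simp: adapted_basis_def)
  next
    case 3
    then have "carrier (M (i + s)) = {\<zero>\<^bsub>M (i + s)\<^esub>}"
      by (intro zero_outside) simp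
    then have "kernel_step M \<phi> i s = carrier (M i)"
      using comp_map_closed[of i "i + s"] by (auto simp: kernel_step_eq)
    then show ?thesis
      using that[of "V i"] V_basis(4)[OF assms] by (simp add: step.basis_def)
  qed
qed

lemma V_Birth_carrier: "i \<in> {1..n} \<Longrightarrow> V_Birth i \<subseteq> carrier (M i)"
  using V_basis(2) V_Birth_eq by blast

lemma finite_births: "finite births"
  unfolding births_def using V_basis(1) V_Birth_eq by (intro finite_SigmaI) auto

lemma births_carrier: "(b, v) \<in> births \<Longrightarrow> v \<in> carrier (M b)"
  using V_Birth_carrier by (auto simp: births_def)

lemma I_submodule: "h \<in> births \<Longrightarrow> submodule K (I i h) (M i)"
  using interval_step_submodule births_carrier by (cases h) auto

lemma I_carrier: "f \<in> Pi births (I i) \<Longrightarrow> f \<in> births \<rightarrow> carrier (M i)"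
  using I_submodule submodule.subset by (fastforce simp: Pi_iff)

text \<open>The births are split into those of degree \<open>Suc i\<close> and all others. The
  others contribute the image of the whole sum of \<open>g\<close>, because \<open>g\<close>
  vanishes at the births of degree \<open>Suc i\<close>.\<close>

lemma finsum_births_Suc:
  assumes g: "g \<in> Pi births (I i)" and f: "f \<in> Pi births (I (Suc i))"
    and fg: "\<And>h. h \<in> births \<Longrightarrow> fst h \<noteq> Suc i \<Longrightarrow> f h = \<phi> i (g h)"
    and i: "Suc i \<in> {1..n}"
  shows "finsum (M (Suc i)) f births =
    \<phi> i (finsum (M i) g births) \<oplus>\<^bsub>M (Suc i)\<^esub>
    finsum (M (Suc i)) (\<lambda>v. f (Suc i, v)) (V_Birth (Suc i))"
proof -
  let ?old = "{h \<in> births. fst h \<noteq> Suc i}" and ?new = "Pair (Suc i) ` V_Birth (Suc i)"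
  have births: "births = ?old \<union> ?new" "?old \<inter> ?new = {}"
    using i by (auto simp: births_def)
  have new: "?new \<subseteq> births"
    using births by blast
  have fin: "finite ?old" "finite ?new"
    using finite_births finite_subset[OF new] by auto
  note fc = I_carrier[OF f] and gc = I_carrier[OF g]
  \<comment> \<open>An interval born in degree \<open>Suc i\<close> is still zero in degree
    \<open>i\<close>.\<close>
  have gnew: "g h = \<zero>\<^bsub>M i\<^esub>" if "h \<in> ?new" for h
    using that new g interval_step_before[of i "Suc i"] by (fastforce simp: Pi_iff)
  have "finsum (M (Suc i)) f births =
      finsum (M (Suc i)) f ?old \<oplus>\<^bsub>M (Suc i)\<^esub> finsum (M (Suc i)) f ?new"
    using fc new
    by (subst births(1), intro step.M.finsum_Un_disjoint fin births(2)) auto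
  also have "finsum (M (Suc i)) f ?old = finsum (M (Suc i)) (\<lambda>h. \<phi> i (g h)) births"
    using fc gc fg gnew
    by (intro step.M.add.finprod_mono_neutral_cong_left finite_births) (auto simp: births_def)
  also have "\<dots> = \<phi> i (finsum (M i) g births)"
    using map.f_finsum[OF gc] by simp
  also have "finsum (M (Suc i)) f ?new = finsum (M (Suc i)) (\<lambda>v. f (Suc i, v)) (V_Birth (Suc i))"
    using fc new by (intro step.M.finsum_reindex) (auto simp: inj_on_def)
  finally show ?thesis .
qed

section \<open>Independence of the intervals, modulo kernels\<close>

lemma finsum_births_in_kernel:
  assumes "f \<in> Pi births (I i)" "finsum (M i) f births \<in> kernel_step M \<phi> i s" "h \<in> births"
  shows "f h \<in> kernel_step M \<phi> i s"
  using assms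
proof (induction i arbitrary: f s h)
  case 0
  have "f h \<in> carrier (M 0)"
    using I_carrier[OF 0(1)] 0(3) by blast
  then have "f h = \<zero>\<^bsub>M 0\<^esub>"
    using zero_outside[of 0] by simp
  then show ?case
    using submodule.zero_closed[OF kernel_step_submodule] by metis
next
  case (Suc i)
  show ?case
  proof (cases "Suc i \<in> {1..n}")
    case False
    have "f h \<in> carrier (M (Suc i))"
      using I_carrier[OF Suc.prems(1)] Suc.prems(3) by blast
    then have "f h = \<zero>\<^bsub>M (Suc i)\<^esub>"
      using zero_outside[OF False] by simp
    then show ?thesis
      using submodule.zero_closed[OF kernel_step_submodule] by metis
  next
    case True
    \<comment> \<open>Every summand of an interval not born in degree \<open>Suc i\<close> has a
      preimage in the same interval one degree lower. At the births of degree \<open>Suc i\<close>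
      nothing is asked beyond membership, so zero serves.\<close>
    have "\<exists>x\<in>I i h. fst h \<noteq> Suc i \<longrightarrow> f h = \<phi> i x" if "h \<in> births" for h
    proof (cases "fst h = Suc i")
      case True
      then show ?thesis
        using submodule.zero_closed[OF I_submodule[OF that]] by blast
    next
      case False
      then have "I (Suc i) h = \<phi> i ` I i h"
        using interval_step_Suc births_carrier that by (cases h) auto
      then show ?thesis
        using Suc.prems(1) that by blast
    qed
    then obtain g where g: "g \<in> Pi births (I i)"
      "\<And>h. h \<in> births \<Longrightarrow> fst h \<noteq> Suc i \<Longrightarrow> f h = \<phi> i (g h)"
      by (metis Pi_I)
    define w where "w = finsum (M i) g births"
    have w: "w \<in> carrier (M i)"
      unfolding w_def using I_carrier[OF g(1)] by (rule step.M.finsum_closed)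
    have birth: "f (Suc i, v) \<in> step.span (Suc i) {v}" if "v \<in> V (Suc i) - V_Im (Suc i)" for v
      using that Suc.prems(1) True V_Birth_eq[OF True]
      by (auto simp: births_def Pi_iff simp flip: interval_step_birth)
    obtain C where C: "C \<subseteq> V (Suc i)" "kernel_step M \<phi> (Suc i) s = step.span (Suc i) C"
      using kernel_step_is_span[OF True] by metis
    have "\<phi> i w \<oplus>\<^bsub>M (Suc i)\<^esub>
        finsum (M (Suc i)) (\<lambda>v. f (Suc i, v)) (V (Suc i) - V_Im (Suc i)) \<in> step.span (Suc i) C"
      using Suc.prems(2) finsum_births_Suc[OF g(1) Suc.prems(1) g(2) True] C(2)
      by (simp add: w_def V_Birth_eq[OF True])
    \<comment> \<open>Here \<open>A\<close> is \<open>V_Im (Suc i)\<close>, whose span is the image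
      of \<open>\<phi> i\<close>, and \<open>y\<close> is \<open>\<phi> i w\<close>. So
      \<open>\<phi> i w\<close> and each birth summand lie in the kernel.\<close>
    note split = step.adapted_decomposition[OF V_basis(1-3)[OF True] V_Im_subset[OF True] C(1) _
        birth this, unfolded span_V_Im[OF True], OF imageI[OF w]]
    have "w \<in> kernel_step M \<phi> i (Suc s)"
      using split(1) map_in_kernel_step_iff[OF w, of s] unfolding C(2) by blast
    then have old: "g h \<in> kernel_step M \<phi> i (Suc s)"
      using Suc.IH[OF g(1)] Suc.prems(3) by (simp add: w_def)
    show ?thesis
    proof (cases "fst h = Suc i")
      case True
      then show ?thesis
        using split(2)[of "snd h"] Suc.prems(3) C(2) V_Birth_eq[of "Suc i"]
        by (cases h) (auto simp: births_def)
    next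
      case False
      have "g h \<in> carrier (M i)"
        using I_carrier[OF g(1)] Suc.prems(3) by blast
      then show ?thesis
        using old map_in_kernel_step_iff g(2)[OF Suc.prems(3) False] by simp
    qed
  qed
qed

section \<open>Generation of every degree by the births\<close>

lemma finsum_births_surj:
  assumes "x \<in> carrier (M i)"
  shows "\<exists>f \<in> Pi births (I i). finsum (M i) f births = x"
proof -
  \<comment> \<open>Degree 0, where the induction starts, and the degrees above \<open>n\<close>
    carry zero spaces, so the zero family suffices.\<close>
  have trivial: "\<exists>f \<in> Pi births (I i). finsum (M i) f births = x"
    if "i \<notin> {1..n}" "x \<in> carrier (M i)" for i x
  proof (intro bexI)
    show "(\<lambda>_. \<zero>\<^bsub>M i\<^esub>) \<in> Pi births (I i)"
      using submodule.zero_closed[OF I_submodule] by blast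
    show "finsum (M i) (\<lambda>_. \<zero>\<^bsub>M i\<^esub>) births = x"
      using that zero_outside[of i] by simp
  qed
  show ?thesis
    using assms
  proof (induction i arbitrary: x)
    case 0
    then show ?case
      by (intro trivial) auto
  next
    case (Suc i)
    show ?case
    proof (cases "Suc i \<in> {1..n}")
      case False
      then show ?thesis
        using Suc.prems by (rule trivial)
    next
      case True
      have V: "V_Im (Suc i) \<subseteq> carrier (M (Suc i))" "V_Birth (Suc i) \<subseteq> carrier (M (Suc i))"
        "finite (V_Im (Suc i))" "finite (V_Birth (Suc i))"
        "V_Im (Suc i) \<inter> V_Birth (Suc i) = {}" "V_Im (Suc i) \<union> V_Birth (Suc i) = V (Suc i)"
        using V_basis[OF True] V_Im_subset[OF True] V_Birth_eq[OF True]
        by (auto intro: finite_subset)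
      obtain a where a: "a \<in> V (Suc i) \<rightarrow> carrier K" "step.lincomb (Suc i) a (V (Suc i)) = x"
        using step.finite_in_span[OF V_basis(1,2)[OF True], of x] V_basis(4)[OF True] Suc.prems
        by (auto simp: step.basis_def)
      \<comment> \<open>The part of \<open>x\<close> in the image; a preimage \<open>w\<close> of it
        is decomposed by the induction hypothesis.\<close>
      let ?y = "step.lincomb (Suc i) a (V_Im (Suc i))"
      have "?y \<in> step.span (Suc i) (V_Im (Suc i))"
        using step.finite_span[OF V(3,1)] a(1) V(6) by blast
      then obtain w where w: "w \<in> carrier (M i)" "\<phi> i w = ?y"
        using span_V_Im[OF True] by auto
      obtain g where g: "g \<in> Pi births (I i)" "finsum (M i) g births = w"
        using Suc.IH[OF w(1)] by blast
      \<comment> \<open>The decomposition of \<open>w\<close> is pushed forward, and the births of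
        degree \<open>Suc i\<close> receive the remaining coefficients of \<open>x\<close>.\<close>
      define f where "f h = (if fst h = Suc i then a (snd h) \<odot>\<^bsub>M (Suc i)\<^esub> snd h else \<phi> i (g h))" for h
      have f: "f \<in> Pi births (I (Suc i))"
      proof
        fix h assume h: "h \<in> births"
        obtain b v where bv: "h = (b, v)"
          by fastforce
        show "f h \<in> I (Suc i) h"
        proof (cases "b = Suc i")
          case True
          then have "v \<in> V_Birth (Suc i)"
            using h bv by (simp add: births_def)
          then show ?thesis
            using True bv V a(1)
            by (auto simp: f_def interval_step_birth step.span_singleton subsetD)
        next
          case False
          then show ?thesis
            using interval_step_Suc[OF births_carrier] h g(1) bv by (auto simp: f_def Pi_iff)
        qed
      qed
      have "finsum (M (Suc i)) f births = ?y \<oplus>\<^bsub>M (Suc i)\<^esub>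
          finsum (M (Suc i)) (\<lambda>v. f (Suc i, v)) (V_Birth (Suc i))"
        using finsum_births_Suc[OF g(1) f _ True] g(2) w(2) by (simp add: f_def)
      also have "finsum (M (Suc i)) (\<lambda>v. f (Suc i, v)) (V_Birth (Suc i)) =
          step.lincomb (Suc i) a (V_Birth (Suc i))"
        by (simp add: f_def step.lincomb_def)
      also have "?y \<oplus>\<^bsub>M (Suc i)\<^esub> \<dots> = x"
        using step.lincomb_union[OF V(1,2,5,3,4)] a V(6) by simp
      finally show ?thesis
        using f by blast
    qed
  qed
qed

section \<open>The direct sum decomposition and the interval basis\<close>

lemma births_direct_sum: "internal_direct_sum K (M i) births (I i)"
  unfolding internal_direct_sum_def
proof (intro conjI ballI)
  fix h assume "h \<in> births"
  then show "subspace K (I i h) (M i)"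
    by (simp add: subspace_def vector_space I_submodule)
next
  fix x assume x: "x \<in> carrier (M i)"
  show "\<exists>!f. f \<in> Pi\<^sub>E births (I i) \<and> finsum (M i) f births = x"
  proof (rule ex_ex1I)
    obtain f where f: "f \<in> Pi births (I i)" "finsum (M i) f births = x"
      using finsum_births_surj[OF x] by blast
    \<comment> \<open>Uniqueness is among extensional functions, so the decomposition found is
      restricted to \<open>births\<close>, which leaves its sum unchanged.\<close>
    moreover have "finsum (M i) (restrict f births) births = finsum (M i) f births"
      using I_carrier[OF f(1)] by (intro step.M.finsum_cong') auto
    ultimately show "\<exists>f. f \<in> Pi\<^sub>E births (I i) \<and> finsum (M i) f births = x"
      by (intro exI[of _ "restrict f births"]) auto
  next
    fix f g
    assume f: "f \<in> Pi\<^sub>E births (I i) \<and> finsum (M i) f births = x"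
      and g: "g \<in> Pi\<^sub>E births (I i) \<and> finsum (M i) g births = x"
    \<comment> \<open>The difference is written with the scalar minus one, so that closure of
      submodules and linearity of sums apply directly. Its sum is zero, that is, in the kernel for
      \<open>s = 0\<close>, and hence so is each summand.\<close>
    define d where "d h = f h \<oplus>\<^bsub>M i\<^esub> (\<ominus>\<^bsub>K\<^esub> \<one>\<^bsub>K\<^esub>) \<odot>\<^bsub>M i\<^esub> g h" for h
    have fc: "f \<in> births \<rightarrow> carrier (M i)" and gc: "g \<in> births \<rightarrow> carrier (M i)"
      using f g by (auto intro!: I_carrier)
    have d: "d \<in> Pi births (I i)"
    proof
      fix h assume h: "h \<in> births"
      interpret submodule K "I i h" "M i"
        by (rule I_submodule[OF h])
      show "d h \<in> I i h"
        unfolding d_def using f g h by (intro m_closed smult_closed) auto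
    qed
    have "finsum (M i) d births = x \<oplus>\<^bsub>M i\<^esub> (\<ominus>\<^bsub>K\<^esub> \<one>\<^bsub>K\<^esub>) \<odot>\<^bsub>M i\<^esub> x"
      unfolding d_def using f g fc gc finite_births
      by (subst step.M.finsum_addf) (auto simp: step.finsum_smult[symmetric])
    also have "\<dots> = \<zero>\<^bsub>M i\<^esub>"
      using x by (simp add: step.smult_minus_1 step.M.r_neg)
    finally have "d h = \<zero>\<^bsub>M i\<^esub>" if "h \<in> births" for h
      using finsum_births_in_kernel[OF d, of 0 h] that by (simp add: kernel_step_0)
    then have "f h = g h" if "h \<in> births" for h
      using that fc gc by (simp add: d_def step.smult_minus_1 Pi_iff flip: step.M.minus_eq)
    then show "f = g"
      using f g by (auto intro: PiE_ext)
  qed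
qed

lemma births_interval_basis: "interval_basis K M \<phi> births"
proof -
  \<comment> \<open>A birth belongs to a linearly independent set, which cannot contain
    zero.\<close>
  have "v \<noteq> \<zero>\<^bsub>M b\<^esub>" if "(b, v) \<in> births" for b v
  proof -
    from that have "b \<in> {1..n}" "v \<in> V b"
      using V_Birth_eq by (auto simp: births_def)
    then show ?thesis
      using step.vs_zero_lin_dep[OF V_basis(2,3)] by metis
  qed
  then show ?thesis
    unfolding interval_basis_def using finite_births births_carrier births_direct_sum by auto
qed

end

theorem theorem4p5:
  fixes K :: "('a, 'r) ring_scheme"
    and n :: nat
    and M :: "nat \<Rightarrow> ('a, 'v, 'm) module_scheme"
    and \<phi> :: "nat \<Rightarrow> 'v \<Rightarrow> 'v"
    and V V_Im V_Birth :: "nat \<Rightarrow> 'v set"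
    and J :: "nat \<Rightarrow> 'v \<Rightarrow> nat"
  assumes "persistence_module K n M \<phi>"
    and "\<And>i. i \<in> {1..n} \<Longrightarrow> adapted_basis K n M \<phi> i (V i) (J i)"
    and "\<And>i. i \<in> {1..n} \<Longrightarrow> V_Im i \<subseteq> V i"
    and "\<And>i. i \<in> {1..n} \<Longrightarrow>
      vectorspace.basis K ((M i)\<lparr>carrier := mod_hom.im (M (i - 1)) (\<phi> (i - 1))\<rparr>) (V_Im i)"
    and "\<And>i. i \<in> {1..n} \<Longrightarrow> V_Birth i = V i - V_Im i"
  shows "interval_basis K M \<phi> (SIGMA i:{1..n}. V_Birth i)"
proof -
  interpret adapted_bases K n M \<phi> V V_Im V_Birth J
    using assms by (intro adapted_bases.intro adapted_bases_axioms.intro)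
  show ?thesis
    using births_interval_basis by (simp add: births_def)
qed

end
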